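(* Let $\alpha>0$ and $x\in(0,1)$. For each $n\in\mathbb{N}$ let $S_{\alpha,x}^{(n)}$ be a random variable whose law is the $\alpha$-fractional binomial distribution $\mu_{\alpha,x}^{(n)}$. Then the sequence of laws of $S_{\alpha,x}^{(n)}/n$, $n\in\mathbb{N}$, satisfies the large deviation principle with speed $n$ and good rate function $$I_{\alpha,x}^{(\mathrm{L})}(z)=\begin{cases}\alpha\left\{z\log\dfrac{z}{x}+(1-z)\log\dfrac{1-z}{1-x}\right\} & \text{if } z\in[0,1],\\ +\infty & \text{otherwise.}\end{cases}$$ Namely, $I_{\alpha,x}^{(\mathrm{L})}$ is a good rate function and the following two properties hold. (1) For any closed set $F\subset\mathbb{R}$, $$\limsup_{n\to\infty}\frac1n\log\mathbb{P}\left(\frac{S_{\alpha,x}^{(n)}}{n}\in F\right)\le-\inf_{z\in F}I_{\alpha,x}^{(\mathrm{L})}(z).$$ (2) For any open set $G\subset\mathbb{R}$, $$\liminf_{n\to\infty}\frac1n\log\mathbb{P}\left(\frac{S_{\alpha,x}^{(n)}}{n}\in G\right)\ge-\inf_{z\in G}I_{\alpha,x}^{(\mathrm{L})}(z).$$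
   Context: $\mathbb{N}=\{1,2,3,\dots\}$. For real $w>-1$ and $z$ with $-1<z<w+1$, $\binom{w}{z}:=\frac{\Gamma(w+1)}{\Gamma(z+1)\Gamma(w-z+1)}$, where $\Gamma$ is the gamma function. For $\alpha>0$, $n\in\mathbb{N}$, $x\in[0,1]$, the $\alpha$-fractional binomial distribution $\mu_{\alpha,x}^{(n)}$ is the probability measure on $\{0,1,\dots,n\}$ defined by $$\mu_{\alpha,x}^{(n)}=\frac{\alpha}{Z_{\alpha,x}^{(n)}}\sum_{j=0}^n\binom{\alpha n}{\alpha j}x^{\alpha j}(1-x)^{\alpha(n-j)}\delta_j,\qquad Z_{\alpha,x}^{(n)}=\alpha\sum_{j=0}^n\binom{\alpha n}{\alpha j}x^{\alpha j}(1-x)^{\alpha(n-j)},$$ where $\delta_j$ is the Dirac measure at $j$ (and $0^0=1$). A rate function is a lower semicontinuous map $I:\mathbb{R}\to[0,\infty]$; it is good if each level set $\{z\in\mathbb{R}\mid I(z)\le a\}$, $a\ge0$, is compact. Conventions: $0\log 0=0$, $\log 0=-\infty$, $\inf\emptyset=+\infty$. *)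

theory Defs
  imports "HOL-Probability.Probability"
begin

text \<open>The binomial coefficient with real arguments, meaningful for \<open>-1 < z < w + 1\<close>.\<close>

definition real_binomial :: "real \<Rightarrow> real \<Rightarrow> real" where
  "real_binomial w z = Gamma (w + 1) / (Gamma (z + 1) * Gamma (w - z + 1))"

text \<open>\<^const>\<open>powr\<close> has \<open>0 powr 0 = 0\<close>; here \<open>0\<close> to the power \<open>0\<close> is \<open>1\<close>.\<close>

definition rpow :: "real \<Rightarrow> real \<Rightarrow> real" where
  "rpow b a = (if a = 0 then 1 else b powr a)"

definition frac_binomial_weight :: "real \<Rightarrow> real \<Rightarrow> nat \<Rightarrow> nat \<Rightarrow> real" where
  "frac_binomial_weight \<alpha> x n j =
     real_binomial (\<alpha> * real n) (\<alpha> * real j) *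
       rpow x (\<alpha> * real j) * rpow (1 - x) (\<alpha> * real (n - j))"

definition frac_binomial_Z :: "real \<Rightarrow> real \<Rightarrow> nat \<Rightarrow> real" where
  "frac_binomial_Z \<alpha> x n = \<alpha> * (\<Sum>j=0..n. frac_binomial_weight \<alpha> x n j)"

definition frac_binomial :: "real \<Rightarrow> real \<Rightarrow> nat \<Rightarrow> nat measure" where
  "frac_binomial \<alpha> x n =
     point_measure {0..n}
       (\<lambda>j. ennreal (\<alpha> / frac_binomial_Z \<alpha> x n * frac_binomial_weight \<alpha> x n j))"

definition lower_semicontinuous :: "('a::topological_space \<Rightarrow> ereal) \<Rightarrow> bool" where
  "lower_semicontinuous f \<longleftrightarrow> (\<forall>z. \<forall>c < f z. \<forall>\<^sub>F y in nhds z. c < f y)"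

definition rate_function :: "(real \<Rightarrow> ereal) \<Rightarrow> bool" where
  "rate_function I \<longleftrightarrow> (\<forall>z. 0 \<le> I z) \<and> lower_semicontinuous I"

definition good_rate_function :: "(real \<Rightarrow> ereal) \<Rightarrow> bool" where
  "good_rate_function I \<longleftrightarrow> rate_function I \<and> (\<forall>a::real. 0 \<le> a \<longrightarrow> compact {z. I z \<le> ereal a})"

text \<open>The logarithm of a probability, with \<open>log 0 = -\<infinity>\<close> (\<^const>\<open>ln\<close> itself has \<open>ln 0 = 0\<close>).\<close>

definition elog :: "real \<Rightarrow> ereal" where
  "elog p = (if p = 0 then -\<infinity> else ereal (ln p))"

text \<open>Large deviation principle for a sequence \<open>\<nu>\<close> of Borel probability measures on the real line
  with speed \<open>s\<close> and good rate function \<open>I\<close>. The infimum is taken in the extended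
  reals, so it is \<open>\<infinity>\<close> over the empty set.\<close>

definition satisfies_good_LDP ::
  "(nat \<Rightarrow> real measure) \<Rightarrow> (nat \<Rightarrow> real) \<Rightarrow> (real \<Rightarrow> ereal) \<Rightarrow> bool" where
  "satisfies_good_LDP \<nu> s I \<longleftrightarrow>
     good_rate_function I \<and>
     (\<forall>F. closed F \<longrightarrow>
        limsup (\<lambda>n. ereal (1 / s n) * elog (measure (\<nu> n) F)) \<le> - (INF z\<in>F. I z)) \<and>
     (\<forall>G. open G \<longrightarrow>
        liminf (\<lambda>n. ereal (1 / s n) * elog (measure (\<nu> n) G)) \<ge> - (INF z\<in>G. I z))"

text \<open>At the endpoints the value of \<^const>\<open>ln\<close> at \<open>0\<close> is multiplied by \<open>0\<close>, which gives the
  convention \<open>0 log 0 = 0\<close>.\<close>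

definition rate_L :: "real \<Rightarrow> real \<Rightarrow> real \<Rightarrow> ereal" where
  "rate_L \<alpha> x z =
     (if z \<in> {0..1}
      then ereal (\<alpha> * (z * ln (z / x) + (1 - z) * ln ((1 - z) / (1 - x))))
      else \<infinity>)"

end

theory Submission
  imports Defs "HOL-Real_Asymp.Real_Asymp"
begin

text \<open>
  The remainder \<open>R t = ln (Gamma (t + 1)) - (t ln t - t)\<close> has derivative
  \<open>Digamma (t + 1) - ln t\<close>, which lies between \<open>0\<close> and \<open>1 / t\<close> because \<open>Gamma\<close> is log-convex.
  Hence \<open>0 \<le> R t \<le> 1 + ln (1 + t)\<close> on \<open>[0, \<infinity>)\<close>, and the logarithm of the \<open>j\<close>-th weight is
  \<open>- n I (j / n)\<close> up to an error \<open>O(ln n)\<close> uniform in \<open>j\<close>. The \<open>n + 1\<close> atoms and the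
  normalising constant (whose logarithm is \<open>o(n)\<close>, as seen from the atom just below \<open>n x\<close>) also
  contribute only \<open>o(n)\<close>, so the upper bound follows from the largest atom in the set and the
  lower bound from a single atom approaching a given point of it.
\<close>

section \<open>Elementary facts on logarithms and lattice points\<close>

lemma continuous_on_mult_ln: "continuous_on {0..} (\<lambda>t::real. t * ln t)"
proof -
  \<comment> \<open>Only the endpoint is delicate: the factor 0 makes the value there 0, which is
    also the limit from the right.\<close>
  have "((\<lambda>t::real. t * ln t) \<longlongrightarrow> 0) (at_right 0)" by real_asymp
  then have "((\<lambda>t::real. t * ln t) \<longlongrightarrow> 0 * ln 0) (at 0 within {0..})"
    by (simp add: at_within_Ici_at_right)
  moreover have "((\<lambda>t::real. t * ln t) \<longlongrightarrow> s * ln s) (at s within {0..})" if "s > 0" for s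
    using that by (auto intro!: tendsto_intros)
  ultimately show ?thesis
    unfolding continuous_on_def by (metis atLeast_iff order_le_less)
qed

text \<open>This is \<open>ln u \<le> u - 1\<close> at \<open>u = b / a\<close>, multiplied by
  \<open>- a\<close>. Added up for the pairs \<open>z, x\<close> and \<open>1 - z, 1 - x\<close>,
  the left-hand sides cancel, so relative entropy is nonnegative.\<close>

lemma mult_ln_divide_ge:
  fixes a b :: real
  assumes "a \<ge> 0" "b > 0"
  shows "a - b \<le> a * ln (a / b)"
proof (cases "a = 0")
  case False
  then have "ln (b / a) \<le> b / a - 1" using assms by (intro ln_le_minus_one) auto
  then have "a * ln (b / a) \<le> a * (b / a - 1)" using assms by (intro mult_left_mono) auto
  then show ?thesis using False assms by (simp add: ln_div algebra_simps)
qed (use assms in auto)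

lemma le_exp_if_ln_le: "0 < w \<Longrightarrow> ln w \<le> y \<Longrightarrow> w \<le> exp y" for w y :: real
  by (metis exp_le_cancel_iff exp_ln)

lemma nat_floor_le:
  fixes z :: real
  assumes "z \<in> {0..1}"
  shows "nat \<lfloor>n * z\<rfloor> \<le> n"
proof -
  have "real n * z \<le> real n" using assms by (simp add: mult_left_le)
  then show ?thesis by (simp add: nat_le_iff floor_le_iff)
qed

text \<open>These lattice points supply the atoms approaching a given point: \<open>x\<close> when
  bounding the normalising constant, a point of the open set in the lower bound.\<close>

lemma tendsto_floor_divide:
  fixes z :: real
  assumes "z \<ge> 0"
  shows "(\<lambda>n. real (nat \<lfloor>n * z\<rfloor>) / n) \<longlonglongrightarrow> z"
proof -
  have "(\<lambda>n. z - 1 / real n) \<longlonglongrightarrow> z" by real_asymp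
  then show ?thesis
  proof (rule tendsto_sandwich[rotated 2])
    show "(\<lambda>n. z) \<longlonglongrightarrow> z" by simp
    have *: "real n * z - 1 \<le> nat \<lfloor>n * z\<rfloor>" "nat \<lfloor>n * z\<rfloor> \<le> real n * z" for n :: nat
      using assms by (simp_all add: of_nat_nat)
    show "\<forall>\<^sub>F n in sequentially. z - 1 / real n \<le> real (nat \<lfloor>n * z\<rfloor>) / n"
      using eventually_gt_at_top[of 0]
    proof eventually_elim
      case (elim n)
      then show ?case using divide_right_mono[OF *(1)[of n], of n] by (simp add: diff_divide_distrib)
    qed
    show "\<forall>\<^sub>F n in sequentially. real (nat \<lfloor>n * z\<rfloor>) / n \<le> z"
      using eventually_gt_at_top[of 0]
    proof eventually_elim
      case (elim n)
      then show ?case using *(2)[of n] by (simp add: field_simps)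
    qed
  qed
qed

section \<open>Logarithmic control of the remainder in Stirling's formula\<close>

lemma ln_between_Digamma:
  fixes t :: real
  assumes "t > 0"
  shows "Digamma t \<le> ln t" "ln t \<le> Digamma (t + 1)"
proof -
  \<comment> \<open>By the functional equation the increment of \<open>ln_Gamma\<close> over
    \<open>[t, t + 1]\<close> is \<open>ln t\<close>, so \<open>ln t\<close> is a value of
    \<open>Digamma\<close> inside that interval; monotonicity of \<open>Digamma\<close> does the
    rest.\<close>
  have "\<exists>s. t < s \<and> s < t + 1 \<and> ln_Gamma (t + 1) - ln_Gamma t = (t + 1 - t) * Digamma s"
    by (rule MVT2) (use assms in \<open>auto intro!: has_field_derivative_ln_Gamma_real\<close>)
  moreover have "ln_Gamma (t + 1) - ln_Gamma t = ln t"
  proof -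
    have "Gamma (t + 1) = t * Gamma t"
      using assms by (intro Gamma_plus1) (auto elim!: nonpos_Ints_cases)
    then show ?thesis
      using assms less_imp_neq[OF Gamma_real_pos[OF assms]] by (simp add: ln_Gamma_real_pos ln_mult)
  qed
  ultimately obtain s where s: "t < s" "s < t + 1" "ln t = Digamma s" by auto
  with assms show "Digamma t \<le> ln t" "ln t \<le> Digamma (t + 1)"
    by (auto intro!: Digamma_real_mono)
qed

text \<open>Stirling's logarithmic correction stays inside the remainder: terms of order
  \<open>ln n\<close> vanish after division by \<open>n\<close>.\<close>

definition Stirling_remainder :: "real \<Rightarrow> real" where
  "Stirling_remainder t = ln (Gamma (t + 1)) - (t * ln t - t)"

lemma Stirling_remainder_0 [simp]: "Stirling_remainder 0 = 0"
  and Stirling_remainder_1 [simp]: "Stirling_remainder 1 = 1"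
  using Gamma_fact[of 0, where 'a = real] Gamma_fact[of 1, where 'a = real]
  by (simp_all add: Stirling_remainder_def add.commute)

lemma has_real_derivative_Stirling_remainder:
  assumes "t > 0"
  shows "(Stirling_remainder has_real_derivative Digamma (t + 1) - ln t) (at t)"
proof -
  have "((\<lambda>t. ln_Gamma (t + 1) - (t * ln t - t)) has_real_derivative Digamma (t + 1) - ln t) (at t)"
    using assms by (auto intro!: derivative_eq_intros)
  \<comment> \<open>The identity with \<open>ln_Gamma\<close> is available for positive arguments,
    so the derivative is carried over through a neighbourhood of \<open>t\<close> inside the
    half-line.\<close>
  moreover have "\<forall>\<^sub>F s in nhds t. s \<in> {0<..}"
    using assms by (intro eventually_nhds_in_open) auto
  then have "\<forall>\<^sub>F s in nhds t. ln_Gamma (s + 1) - (s * ln s - s) = Stirling_remainder s"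
    by eventually_elim (simp add: Stirling_remainder_def ln_Gamma_real_pos)
  ultimately show ?thesis
    using DERIV_cong_ev[of t t] by fastforce
qed

lemma continuous_on_Stirling_remainder: "continuous_on {0..} Stirling_remainder"
proof -
  have "continuous_on {0..} (\<lambda>t::real. Gamma (t + 1))"
    by (rule continuous_on_compose2[OF continuous_on_Gamma[of "{0<..}"]])
      (auto intro!: continuous_intros elim!: nonpos_Ints_cases)
  moreover have "Gamma (t + 1) \<noteq> 0" if "t \<in> {0..}" for t :: real
    using less_imp_neq[OF Gamma_real_pos, of "t + 1"] that by auto
  ultimately show ?thesis
    unfolding Stirling_remainder_def[abs_def]
    by (intro continuous_intros continuous_on_mult_ln) auto
qed

text \<open>The derivative is known only for positive arguments. To reach \<open>s = 0\<close>, its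
  sign is used on the open interval together with continuity up to the ends.\<close>

lemma Stirling_remainder_mono:
  assumes "0 \<le> s" "s \<le> t"
  shows "Stirling_remainder s \<le> Stirling_remainder t"
proof (rule DERIV_nonneg_imp_increasing_open[OF \<open>s \<le> t\<close>])
  show "continuous_on {s..t} Stirling_remainder"
    using assms by (intro continuous_on_subset[OF continuous_on_Stirling_remainder]) auto
  fix u assume "s < u" "u < t"
  then show "\<exists>y. (Stirling_remainder has_real_derivative y) (at u) \<and> 0 \<le> y"
    using assms has_real_derivative_Stirling_remainder[of u] ln_between_Digamma(2)[of u] by force
qed

lemma Stirling_remainder_bounds:
  assumes "0 \<le> t"
  shows "0 \<le> Stirling_remainder t" "Stirling_remainder t \<le> 1 + ln (1 + t)"
proof -
  show "0 \<le> Stirling_remainder t"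
    using Stirling_remainder_mono[of 0 t] assms by simp
  show "Stirling_remainder t \<le> 1 + ln (1 + t)"
  proof (cases "t \<le> 1")
    case True
    have "Stirling_remainder t \<le> 1" using Stirling_remainder_mono[of t 1] True assms by simp
    moreover have "0 \<le> ln (1 + t)" using assms by simp
    ultimately show ?thesis by linarith
  next
    case False
    \<comment> \<open>The derivative of the difference is \<open>ln u - Digamma u \<ge> 0\<close>,
      by the recurrence for \<open>Digamma\<close>. Starting at 1 avoids the singularity of
      \<open>ln\<close> at 0, and \<open>Stirling_remainder 1 = 1\<close> is the constant in the
      bound.\<close>
    have "ln 1 - Stirling_remainder 1 \<le> ln t - Stirling_remainder t"
    proof (rule DERIV_nonneg_imp_nondecreasing[where f = "\<lambda>u. ln u - Stirling_remainder u"])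
      fix u :: real assume "1 \<le> u" "u \<le> t"
      moreover from this have "((\<lambda>u. ln u - Stirling_remainder u) has_real_derivative
          1 / u - (Digamma (u + 1) - ln u)) (at u)"
        by (auto intro!: derivative_eq_intros has_real_derivative_Stirling_remainder)
      moreover have "Digamma (u + 1) = Digamma u + 1 / u"
        using \<open>1 \<le> u\<close> by (intro Digamma_plus1) auto
      ultimately show "\<exists>y. ((\<lambda>u. ln u - Stirling_remainder u) has_real_derivative y) (at u) \<and> 0 \<le> y"
        using ln_between_Digamma(1)[of u] by (intro exI[of _ "1 / u - (Digamma (u + 1) - ln u)"]) auto
    qed (use False in auto)
    moreover have "ln t \<le> ln (1 + t)" using False by simp
    ultimately show ?thesis by simp
  qed
qed

section \<open>The rate function and its goodness\<close>

definition rate_real :: "real \<Rightarrow> real \<Rightarrow> real \<Rightarrow> real" where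
  "rate_real \<alpha> x z = \<alpha> * (z * ln (z / x) + (1 - z) * ln ((1 - z) / (1 - x)))"

lemma rate_L_eq: "rate_L \<alpha> x z = (if z \<in> {0..1} then ereal (rate_real \<alpha> x z) else \<infinity>)"
  by (simp add: rate_L_def rate_real_def)

context
  fixes \<alpha> x :: real
  assumes alpha: "\<alpha> > 0" and x: "0 < x" "x < 1"
begin

text \<open>This zero is why the normalising constant is not exponentially small: atoms near
  \<open>n * x\<close> cost nothing on the exponential scale.\<close>

lemma rate_real_self: "rate_real \<alpha> x x = 0"
  using x by (simp add: rate_real_def)

lemma rate_real_nonneg:
  assumes "z \<in> {0..1}"
  shows "0 \<le> rate_real \<alpha> x z"
  using mult_ln_divide_ge[of z x] mult_ln_divide_ge[of "1 - z" "1 - x"] assms x alpha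
  by (simp add: rate_real_def)

lemma continuous_on_rate_real: "continuous_on {0..1} (rate_real \<alpha> x)"
proof -
  have 1: "continuous_on {0..1} (\<lambda>z::real. z * ln z)"
    by (rule continuous_on_subset[OF continuous_on_mult_ln]) auto
  have 2: "continuous_on {0..1} (\<lambda>z::real. (1 - z) * ln (1 - z))"
    by (rule continuous_on_compose2[OF continuous_on_mult_ln]) (auto intro!: continuous_intros)
  have cont: "continuous_on {0..1}
      (\<lambda>z. \<alpha> * ((z * ln z - z * ln x) + ((1 - z) * ln (1 - z) - (1 - z) * ln (1 - x))))"
    by (intro continuous_intros 1 2)
  \<comment> \<open>The splitting survives at \<open>a = 0\<close>, where the prefactor annihilates
    every term.\<close>
  have "a * ln (a / b) = a * ln a - a * ln b" if "a \<ge> 0" "b > 0" for a b :: real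
    using that by (cases "a = 0") (auto simp: ln_div algebra_simps)
  then have eq: "rate_real \<alpha> x z =
      \<alpha> * ((z * ln z - z * ln x) + ((1 - z) * ln (1 - z) - (1 - z) * ln (1 - x)))" if "z \<in> {0..1}" for z
    using x that by (simp add: rate_real_def)
  show ?thesis by (rule continuous_on_eq[OF cont]) (rule eq[symmetric])
qed

text \<open>Level sets are closed in \<open>[0, 1]\<close> by continuity of the real formula there,
  hence compact. Lower semicontinuity then follows, since the complements of level sets are
  open.\<close>

lemma good_rate_function_rate_L: "good_rate_function (rate_L \<alpha> x)"
  unfolding good_rate_function_def rate_function_def
proof (intro conjI allI impI)
  show "0 \<le> rate_L \<alpha> x z" for z
    using rate_real_nonneg by (simp add: rate_L_eq)
  have level: "compact {z. rate_L \<alpha> x z \<le> ereal a}" for a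
  proof -
    have "closed {z \<in> {0..1}. rate_real \<alpha> x z \<le> a}"
      by (intro continuous_on_closed_Collect_le continuous_intros continuous_on_rate_real)
    moreover have "{z. rate_L \<alpha> x z \<le> ereal a} = {z \<in> {0..1}. rate_real \<alpha> x z \<le> a}"
      by (auto simp: rate_L_eq split: if_splits)
    moreover have "bounded {z \<in> {0..1}. rate_real \<alpha> x z \<le> a}"
      by (rule bounded_subset[of "{0..1}"]) auto
    ultimately show ?thesis by (simp add: compact_eq_bounded_closed)
  qed
  then show "compact {z. rate_L \<alpha> x z \<le> ereal a}" for a .
  show "lower_semicontinuous (rate_L \<alpha> x)"
    unfolding lower_semicontinuous_def
  proof (intro allI impI)
    fix z c assume c: "c < rate_L \<alpha> x z"
    \<comment> \<open>A real level strictly between \<open>c\<close> and the value at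
      \<open>z\<close> puts \<open>z\<close> into an open superlevel set on which the rate exceeds
      \<open>c\<close>.\<close>
    then obtain a where a: "c < ereal a" "ereal a < rate_L \<alpha> x z"
      using ereal_dense2 by blast
    have "open (- {z. rate_L \<alpha> x z \<le> ereal a})"
      using level compact_imp_closed by blast
    then have "\<forall>\<^sub>F y in nhds z. y \<in> - {z. rate_L \<alpha> x z \<le> ereal a}"
      using a by (intro eventually_nhds_in_open) auto
    then show "\<forall>\<^sub>F y in nhds z. c < rate_L \<alpha> x y"
      by eventually_elim (use a in auto)
  qed
qed

section \<open>Weights, normalising constant and the scaled law\<close>

abbreviation weight_error :: "nat \<Rightarrow> real" where
  "weight_error n \<equiv> 2 * (1 + ln (1 + \<alpha> * n))"

text \<open>In the logarithm of the gamma quotient the linear terms cancel, and the terms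
  \<open>t * ln t\<close> combine with the powers of \<open>x\<close> and \<open>1 - x\<close> to
  the rate. Three remainders are left, at most two of them with the same sign and each bounded
  through the largest argument \<open>\<alpha> * n\<close>; hence the factor 2 in
  \<open>weight_error\<close>.\<close>

lemma frac_binomial_weight_bounds:
  fixes n j :: nat
  assumes n: "n \<ge> 1" and j: "j \<le> n"
  defines "E \<equiv> weight_error n"
  defines "w \<equiv> frac_binomial_weight \<alpha> x n j"
  shows "w > 0" "ln w \<le> E - n * rate_real \<alpha> x (j / n)" "- E - n * rate_real \<alpha> x (j / n) \<le> ln w"
proof -
  define a b c where "a = \<alpha> * n" and "b = \<alpha> * j" and "c = \<alpha> * real (n - j)"
  have a: "a > 0" using n alpha by (simp add: a_def)
  have bc: "b \<ge> 0" "c \<ge> 0" "b \<le> a" "c \<le> a" "a - b = c" "a = b + c"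
    using j alpha by (auto simp: a_def b_def c_def of_nat_diff algebra_simps)
  have rp: "rpow y t > 0 \<and> ln (rpow y t) = t * ln y" if "y > 0" for y t
    using that by (auto simp: rpow_def)
  have G: "Gamma (t + 1) > 0" "ln (Gamma (t + 1)) = Stirling_remainder t + t * ln t - t" if "t \<ge> 0" for t
    using that by (auto intro!: Gamma_real_pos simp: Stirling_remainder_def)
  have w: "w = Gamma (a + 1) / (Gamma (b + 1) * Gamma (c + 1)) * rpow x b * rpow (1 - x) c"
    using bc(5) by (simp add: w_def frac_binomial_weight_def real_binomial_def a_def b_def c_def)
  show pos: "w > 0"
    unfolding w using G(1) rp x a bc by simp
  have "ln w = ln (Gamma (a + 1)) - ln (Gamma (b + 1)) - ln (Gamma (c + 1)) + b * ln x + c * ln (1 - x)"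
  proof -
    have *: "Gamma (a + 1) > 0" "Gamma (b + 1) > 0" "Gamma (c + 1) > 0" "rpow x b > 0" "rpow (1 - x) c > 0"
      using G(1) rp x a bc by auto
    have "ln w = ln (Gamma (a + 1)) - ln (Gamma (b + 1)) - ln (Gamma (c + 1)) + ln (rpow x b) + ln (rpow (1 - x) c)"
      unfolding w using * by (simp add: ln_mult ln_div)
    then show ?thesis using rp x by simp
  qed
  also have "\<dots> = Stirling_remainder a - Stirling_remainder b - Stirling_remainder c
      - (b * (ln b - ln a - ln x) + c * (ln c - ln a - ln (1 - x)))"
    using G(2)[of a] G(2)[of b] G(2)[of c] a bc(1,2) unfolding bc(6) by (simp add: algebra_simps)
  also have "b * (ln b - ln a - ln x) + c * (ln c - ln a - ln (1 - x)) = n * rate_real \<alpha> x (j / n)"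
  proof -
    \<comment> \<open>\<open>\<alpha>\<close> cancels in \<open>b / a = j / n\<close>. The extreme
      atoms \<open>j = 0\<close> here and \<open>j = n\<close> below are treated apart: the
      logarithm of a quotient cannot be split there, but the prefactor is 0.\<close>
    have "b * (ln b - ln a - ln x) = b * ln (real j / real n / x)"
      using n alpha x by (cases "j = 0") (auto simp: a_def b_def ln_mult ln_div)
    moreover have "c * (ln c - ln a - ln (1 - x)) = c * ln ((1 - real j / real n) / (1 - x))"
    proof (cases "j = n")
      case False
      have "1 - real j / real n = real (n - j) / n"
        using n j by (simp add: of_nat_diff field_simps)
      then show ?thesis using False j n alpha x by (simp add: a_def c_def ln_mult ln_div)
    qed (simp add: c_def)
    moreover have "b = \<alpha> * (n * (j / n))" "c = \<alpha> * (n * (1 - j / n))"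
      using n j by (simp_all add: b_def c_def of_nat_diff right_diff_distrib)
    ultimately show ?thesis
      unfolding rate_real_def by (simp only: distrib_left mult.assoc mult.left_commute)
  qed
  finally have "ln w = Stirling_remainder a - Stirling_remainder b - Stirling_remainder c
      - n * rate_real \<alpha> x (j / n)" .
  moreover have "0 \<le> Stirling_remainder t \<and> Stirling_remainder t \<le> E / 2" if "0 \<le> t" "t \<le> a" for t
  proof -
    have "Stirling_remainder t \<le> Stirling_remainder a" using that by (rule Stirling_remainder_mono)
    also have "\<dots> \<le> E / 2" using Stirling_remainder_bounds(2)[of a] a by (simp add: E_def a_def)
    finally show ?thesis using that Stirling_remainder_bounds(1) by auto
  qed
  from this[of a] this[of b] this[of c] have "0 \<le> Stirling_remainder a \<and> Stirling_remainder a \<le> E / 2"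
    "0 \<le> Stirling_remainder b \<and> Stirling_remainder b \<le> E / 2"
    "0 \<le> Stirling_remainder c \<and> Stirling_remainder c \<le> E / 2"
    using a bc by auto
  ultimately show "ln w \<le> E - n * rate_real \<alpha> x (j / n)" "- E - n * rate_real \<alpha> x (j / n) \<le> ln w"
    by linarith+
qed


text \<open>The factor \<open>\<alpha>\<close> of \<open>frac_binomial_Z\<close> is left out, as it
  cancels in the point probabilities.\<close>

definition frac_binomial_total :: "nat \<Rightarrow> real" where
  "frac_binomial_total n = (\<Sum>j=0..n. frac_binomial_weight \<alpha> x n j)"

lemma frac_binomial_total_pos:
  assumes "n \<ge> 1"
  shows "frac_binomial_total n > 0"
  unfolding frac_binomial_total_def
  by (intro sum_pos frac_binomial_weight_bounds(1)) (use assms in auto)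

text \<open>Since the rate is nonnegative, each of the \<open>n + 1\<close> weights is at most the
  exponential of the error. This serves the lower bound on probabilities.\<close>

lemma ln_frac_binomial_total_upper:
  assumes "n \<ge> 1"
  shows "ln (frac_binomial_total n) \<le> ln (n + 1) + weight_error n"
proof -
  have "frac_binomial_weight \<alpha> x n j \<le> exp (weight_error n)" if "j \<in> {0..n}" for j
  proof -
    have "real j / n \<in> {0..1}" using that by (auto intro!: divide_le_eq_1[THEN iffD2])
    then have "0 \<le> n * rate_real \<alpha> x (j / n)" by (intro mult_nonneg_nonneg rate_real_nonneg) auto
    then have "ln (frac_binomial_weight \<alpha> x n j) \<le> weight_error n"
      using frac_binomial_weight_bounds(2)[of n j] assms that by simp
    then show ?thesis
      using frac_binomial_weight_bounds(1)[of n j] assms that by (intro le_exp_if_ln_le) auto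
  qed
  then have "frac_binomial_total n \<le> real (n + 1) * exp (weight_error n)"
    unfolding frac_binomial_total_def
    using sum_bounded_above[of "{0..n}" "frac_binomial_weight \<alpha> x n" "exp (weight_error n)"] by simp
  moreover have "frac_binomial_total n > 0" by (rule frac_binomial_total_pos[OF assms])
  ultimately have "ln (frac_binomial_total n) \<le> ln (real (n + 1) * exp (weight_error n))"
    by (subst ln_le_cancel_iff) auto
  then show ?thesis by (simp add: ln_mult add.commute)
qed

text \<open>A sum of positive terms dominates each of them. The index stays free so that it can
  later be placed just below \<open>n * x\<close>, where the rate is nearly 0.\<close>

lemma ln_frac_binomial_total_lower:
  fixes n j :: nat
  assumes "n \<ge> 1" "j \<le> n"
  shows "- weight_error n - n * rate_real \<alpha> x (j / n) \<le> ln (frac_binomial_total n)"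
proof -
  have pos: "frac_binomial_total n > 0" by (rule frac_binomial_total_pos[OF assms(1)])
  have "frac_binomial_weight \<alpha> x n j \<le> frac_binomial_total n"
    unfolding frac_binomial_total_def
    by (rule member_le_sum) (use assms frac_binomial_weight_bounds(1) in \<open>auto intro: less_imp_le\<close>)
  then have "ln (frac_binomial_weight \<alpha> x n j) \<le> ln (frac_binomial_total n)"
    using frac_binomial_weight_bounds(1)[OF assms] pos by simp
  then show "- weight_error n - n * rate_real \<alpha> x (j / n) \<le> ln (frac_binomial_total n)"
    using frac_binomial_weight_bounds(3)[OF assms] by linarith
qed

definition scaled_prob :: "nat \<Rightarrow> real set \<Rightarrow> real" where
  "scaled_prob n A =
     (\<Sum>j\<in>{j\<in>{0..n}. real j / n \<in> A}. frac_binomial_weight \<alpha> x n j) / frac_binomial_total n"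

lemma measure_frac_binomial:
  assumes "n \<ge> 1"
  shows "measure (frac_binomial \<alpha> x n) {j\<in>{0..n}. real j / n \<in> A} = scaled_prob n A"
proof -
  have "frac_binomial_total n > 0" by (rule frac_binomial_total_pos[OF assms])
  \<comment> \<open>\<open>ennreal\<close> truncates negative numbers, so nonnegative point masses
    are required before the sum can be read as a real one.\<close>
  then have nn: "0 \<le> \<alpha> / frac_binomial_Z \<alpha> x n * frac_binomial_weight \<alpha> x n j" if "j \<in> {0..n}" for j
    using alpha frac_binomial_weight_bounds(1)[of n j] assms that
    by (auto simp: frac_binomial_Z_def frac_binomial_total_def)
  have "measure (frac_binomial \<alpha> x n) {j\<in>{0..n}. real j / n \<in> A} =
      (\<Sum>j\<in>{j\<in>{0..n}. real j / n \<in> A}. \<alpha> / frac_binomial_Z \<alpha> x n * frac_binomial_weight \<alpha> x n j)"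
    unfolding frac_binomial_def measure_def using nn
    by (subst emeasure_point_measure_finite, simp, blast, subst sum_ennreal)
      (auto intro!: enn2real_ennreal sum_nonneg)
  then show ?thesis
    using alpha by (simp add: scaled_prob_def frac_binomial_Z_def frac_binomial_total_def
        sum_divide_distrib)
qed

section \<open>Exponential upper and lower bounds\<close>

lemma tendsto_rate_real_floor:
  assumes "z \<in> {0..1}"
  shows "(\<lambda>n. rate_real \<alpha> x (real (nat \<lfloor>n * z\<rfloor>) / n)) \<longlonglongrightarrow> rate_real \<alpha> x z"
proof (rule continuous_on_tendsto_compose[OF continuous_on_rate_real])
  show "(\<lambda>n. real (nat \<lfloor>n * z\<rfloor>) / n) \<longlonglongrightarrow> z"
    using assms by (intro tendsto_floor_divide) auto
  show "\<forall>\<^sub>F n in sequentially. real (nat \<lfloor>n * z\<rfloor>) / n \<in> {0..1}"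
    using eventually_gt_at_top[of 0]
    by eventually_elim (use nat_floor_le[OF assms] in \<open>simp add: divide_le_eq_1\<close>)
qed (use assms in auto)

text \<open>At most \<open>n + 1\<close> atoms lie in \<open>F\<close>, each of weight at most
  \<open>exp (weight_error n - n * m)\<close>. A real \<open>m\<close> in place of the infimum keeps
  the estimate finite when the infimum is infinite.\<close>

lemma scaled_prob_ldp_upper:
  assumes F: "\<And>z. z \<in> F \<Longrightarrow> ereal m \<le> rate_L \<alpha> x z"
  shows "limsup (\<lambda>n. ereal (1 / n) * elog (scaled_prob n F)) \<le> ereal (- m)"
proof -
  \<comment> \<open>The term \<open>ln (n + 1)\<close> counts atoms, one error comes from the
    numerator and one from the normalising constant, and the last rate is that of the atom below
    \<open>n * x\<close>, tending to 0.\<close>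
  define b where "b n = - m + ((ln (real n + 1) + 2 * weight_error n) / n
      + rate_real \<alpha> x (real (nat \<lfloor>n * x\<rfloor>) / n))" for n :: nat
  have "(\<lambda>n. (ln (real n + 1) + 2 * weight_error n) / n) \<longlonglongrightarrow> 0"
    using alpha by real_asymp
  then have "b \<longlonglongrightarrow> - m + (0 + rate_real \<alpha> x x)"
    unfolding b_def by (intro tendsto_intros tendsto_rate_real_floor) (use x in auto)
  then have "(\<lambda>n. ereal (b n)) \<longlonglongrightarrow> ereal (- m)"
    by (simp add: rate_real_self)
  then have "limsup (\<lambda>n. ereal (b n)) = ereal (- m)"
    by (intro lim_imp_Limsup) auto
  moreover have "\<forall>\<^sub>F n in sequentially. ereal (1 / n) * elog (scaled_prob n F) \<le> ereal (b n)"
    using eventually_ge_at_top[of 1]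
  proof eventually_elim
    case (elim n)
    define k where "k = nat \<lfloor>n * x\<rfloor>"
    have k: "k \<le> n" unfolding k_def using x by (intro nat_floor_le) auto
    note W = ln_frac_binomial_total_lower[OF elim k] frac_binomial_total_pos[OF elim]
    let ?J = "{j\<in>{0..n}. real j / n \<in> F}"
    let ?N = "\<Sum>j\<in>?J. frac_binomial_weight \<alpha> x n j"
    show ?case
    proof (cases "?J = {}")
      case True
      \<comment> \<open>With no atom in \<open>F\<close>, \<open>elog\<close> gives
        \<open>-\<infinity>\<close>, and the positive factor \<open>1 / n\<close> preserves
        it.\<close>
      then have "scaled_prob n F = 0" by (simp only: scaled_prob_def) simp
      then show ?thesis using elim by (simp add: elog_def)
    next
      case False
      have "frac_binomial_weight \<alpha> x n j \<le> exp (weight_error n - n * m)" if "j \<in> ?J" for j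
      proof -
        have "real j / n \<in> {0..1}" using that by (auto intro!: divide_le_eq_1[THEN iffD2])
        then have "m \<le> rate_real \<alpha> x (j / n)"
          using F[of "j / n"] that by (simp add: rate_L_eq)
        then have "n * m \<le> n * rate_real \<alpha> x (j / n)" by (intro mult_left_mono) auto
        then have "ln (frac_binomial_weight \<alpha> x n j) \<le> weight_error n - n * m"
          using frac_binomial_weight_bounds(2)[OF elim, of j] that by simp
        then show ?thesis
          using frac_binomial_weight_bounds(1)[OF elim, of j] that by (intro le_exp_if_ln_le) auto
      qed
      then have "?N \<le> real (card ?J) * exp (weight_error n - n * m)"
        by (rule sum_bounded_above)
      also have "\<dots> \<le> (real n + 1) * exp (weight_error n - n * m)"
      proof -
        have "card ?J \<le> card {0..n}" by (rule card_mono) auto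
        then show ?thesis by (intro mult_right_mono) auto
      qed
      finally have N: "?N \<le> (real n + 1) * exp (weight_error n - n * m)" .
      have pos: "?N > 0"
        using False by (intro sum_pos frac_binomial_weight_bounds(1)[OF elim]) auto
      have "ln ?N \<le> ln ((real n + 1) * exp (weight_error n - n * m))"
        using N pos by (subst ln_le_cancel_iff) (auto intro!: mult_pos_pos)
      also have "\<dots> = ln (real n + 1) + weight_error n - n * m"
        by (subst ln_mult) auto
      finally have "ln (scaled_prob n F)
          \<le> ln (real n + 1) + weight_error n - n * m + weight_error n + n * rate_real \<alpha> x (k / n)"
        using W pos by (simp add: scaled_prob_def ln_div)
      moreover have "b n * n = - m * n + (ln (real n + 1) + 2 * weight_error n)
          + n * rate_real \<alpha> x (k / n)"
        using elim unfolding b_def k_def[symmetric] by (simp add: field_simps)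
      ultimately have "ln (scaled_prob n F) / n \<le> b n"
        using elim by (simp add: pos_divide_le_eq mult.commute)
      moreover have "scaled_prob n F \<noteq> 0"
        using W pos by (simp add: scaled_prob_def)
      ultimately show ?thesis by (simp add: elog_def)
    qed
  qed
  ultimately show ?thesis using Limsup_mono by metis
qed

text \<open>Openness puts the atom just below \<open>n * z\<close> eventually inside
  \<open>G\<close>; its weight alone, divided by the upper bound on the total, already has the right
  exponential order.\<close>

lemma scaled_prob_ldp_lower:
  assumes "open G" "z \<in> G" "z \<in> {0..1}"
  shows "ereal (- rate_real \<alpha> x z) \<le> liminf (\<lambda>n. ereal (1 / n) * elog (scaled_prob n G))"
proof -
  define b where "b n = - rate_real \<alpha> x (real (nat \<lfloor>n * z\<rfloor>) / n)
      - (ln (real n + 1) + 2 * weight_error n) / n" for n :: nat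
  have "(\<lambda>n. (ln (real n + 1) + 2 * weight_error n) / n) \<longlonglongrightarrow> 0"
    using alpha by real_asymp
  then have "b \<longlonglongrightarrow> - rate_real \<alpha> x z - 0"
    unfolding b_def by (intro tendsto_intros tendsto_rate_real_floor assms)
  then have "(\<lambda>n. ereal (b n)) \<longlonglongrightarrow> ereal (- rate_real \<alpha> x z)" by simp
  then have "liminf (\<lambda>n. ereal (b n)) = ereal (- rate_real \<alpha> x z)"
    by (intro lim_imp_Liminf) auto
  moreover have "\<forall>\<^sub>F n in sequentially. real (nat \<lfloor>n * z\<rfloor>) / n \<in> G"
    by (rule topological_tendstoD[OF tendsto_floor_divide]) (use assms in auto)
  then have "\<forall>\<^sub>F n in sequentially. ereal (b n) \<le> ereal (1 / n) * elog (scaled_prob n G)"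
    using eventually_ge_at_top[of 1]
  proof eventually_elim
    case (elim n)
    define k where "k = nat \<lfloor>n * z\<rfloor>"
    have k: "k \<le> n" "k / n \<in> G"
      using elim nat_floor_le[OF assms(3)] by (auto simp: k_def)
    let ?J = "{j\<in>{0..n}. real j / n \<in> G}"
    let ?N = "\<Sum>j\<in>?J. frac_binomial_weight \<alpha> x n j"
    note W = frac_binomial_total_pos[OF elim(2)]
      ln_frac_binomial_total_upper[OF elim(2)]
    have kN: "frac_binomial_weight \<alpha> x n k \<le> ?N"
      by (rule member_le_sum)
        (use k frac_binomial_weight_bounds(1)[OF elim(2)] in \<open>auto intro: less_imp_le\<close>)
    note wk = frac_binomial_weight_bounds[OF elim(2) k(1)]
    have "ln (frac_binomial_weight \<alpha> x n k) \<le> ln ?N"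
      using kN wk(1) by (subst ln_le_cancel_iff) auto
    moreover have "ln (scaled_prob n G) = ln ?N - ln (frac_binomial_total n)"
      using W wk(1) kN by (simp add: scaled_prob_def ln_div)
    ultimately have "- weight_error n - n * rate_real \<alpha> x (k / n) - (ln (real n + 1) + weight_error n)
        \<le> ln (scaled_prob n G)"
      using W(2) wk(3) by linarith
    moreover have "b n * n = - n * rate_real \<alpha> x (k / n)
        - (ln (real n + 1) + 2 * weight_error n)"
      using elim by (simp add: b_def k_def left_diff_distrib)
    ultimately have "b n \<le> ln (scaled_prob n G) / n"
      using elim by (simp add: pos_le_divide_eq)
    moreover have "scaled_prob n G \<noteq> 0"
      using W wk kN by (simp add: scaled_prob_def)
    ultimately show ?case by (simp add: elog_def)
  qed
  ultimately show ?thesis using Liminf_mono by metis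
qed

end

section \<open>Transfer to the laws of \<open>S n / n\<close>\<close>

lemma ereal_le_uminusI:
  fixes I L :: ereal
  assumes "0 \<le> I" "\<And>m. ereal m \<le> I \<Longrightarrow> L \<le> ereal (- m)"
  shows "L \<le> - I"
proof (cases I)
  case PInf
  \<comment> \<open>An infinite infimum, as when \<open>F\<close> misses \<open>[0, 1]\<close>,
    admits arbitrarily large \<open>m\<close> and forces \<open>L\<close> to be
    \<open>-\<infinity>\<close>.\<close>
  then have "L \<le> ereal B" for B using assms(2)[of "- B"] by simp
  then show ?thesis using PInf ereal_bot by force
qed (use assms in auto)

theorem theorem2p4:
  fixes \<alpha> x :: real
    and M :: "nat \<Rightarrow> 'a measure"
    and S :: "nat \<Rightarrow> 'a \<Rightarrow> real"
  assumes "\<alpha> > 0" and "0 < x" and "x < 1"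
    and "\<And>n. n \<ge> 1 \<Longrightarrow> prob_space (M n)"
    and "\<And>n. n \<ge> 1 \<Longrightarrow> S n \<in> borel_measurable (M n)"
    and "\<And>n. n \<ge> 1 \<Longrightarrow> distr (M n) borel (S n) = distr (frac_binomial \<alpha> x n) borel real"
  shows "satisfies_good_LDP (\<lambda>n. distr (M n) borel (\<lambda>\<omega>. S n \<omega> / real n)) (\<lambda>n. real n)
           (rate_L \<alpha> x)"
proof -
  define \<nu> where "\<nu> n = distr (M n) borel (\<lambda>\<omega>. S n \<omega> / real n)" for n
  have \<nu>: "measure (\<nu> n) A = scaled_prob \<alpha> x n A" if n: "n \<ge> 1" and A: "A \<in> sets borel" for n A
  proof -
    have [measurable]: "S n \<in> borel_measurable (M n)" by (rule assms(5)[OF n])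
    have [measurable]: "real \<in> borel_measurable (frac_binomial \<alpha> x n)"
      by (simp add: frac_binomial_def measurable_def sets_point_measure space_point_measure)
    \<comment> \<open>Only the law of \<open>S n\<close> is prescribed, so division by
      \<open>n\<close> is split off as a second pushforward before that law is replaced.\<close>
    have "\<nu> n = distr (distr (M n) borel (S n)) borel (\<lambda>s. s / n)"
      unfolding \<nu>_def by (subst distr_distr) (auto simp: o_def)
    also have "\<dots> = distr (frac_binomial \<alpha> x n) borel (\<lambda>j. j / n)"
      unfolding assms(6)[OF n] by (subst distr_distr) (auto simp: o_def)
    finally have "measure (\<nu> n) A =
        measure (frac_binomial \<alpha> x n) ((\<lambda>j. real j / n) -` A \<inter> space (frac_binomial \<alpha> x n))"
      using A by (simp add: measure_distr)
    also have "(\<lambda>j. real j / n) -` A \<inter> space (frac_binomial \<alpha> x n) = {j\<in>{0..n}. real j / n \<in> A}"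
      by (auto simp: frac_binomial_def space_point_measure)
    finally show ?thesis using measure_frac_binomial assms(1-3) n by simp
  qed
  \<comment> \<open>The laws are identified for \<open>n \<ge> 1\<close>, which suffices because
    both limits depend only on eventual values.\<close>
  have ev: "\<forall>\<^sub>F n in sequentially. ereal (1 / n) * elog (measure (\<nu> n) A) =
      ereal (1 / n) * elog (scaled_prob \<alpha> x n A)" if "A \<in> sets borel" for A
    using eventually_ge_at_top[of 1] by eventually_elim (use \<nu> that in simp)
  have good: "good_rate_function (rate_L \<alpha> x)"
    by (rule good_rate_function_rate_L) (use assms in auto)
  then have nonneg: "0 \<le> rate_L \<alpha> x z" for z
    by (simp add: good_rate_function_def rate_function_def)
  have "limsup (\<lambda>n. ereal (1 / n) * elog (measure (\<nu> n) F)) \<le> - (INF z\<in>F. rate_L \<alpha> x z)"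
    if "closed F" for F
  proof (rule ereal_le_uminusI)
    fix m assume "ereal m \<le> (INF z\<in>F. rate_L \<alpha> x z)"
    then have "limsup (\<lambda>n. ereal (1 / n) * elog (scaled_prob \<alpha> x n F)) \<le> ereal (- m)"
      using assms(1-3) by (intro scaled_prob_ldp_upper) (auto simp: le_INF_iff)
    then show "limsup (\<lambda>n. ereal (1 / n) * elog (measure (\<nu> n) F)) \<le> ereal (- m)"
      using that by (subst Limsup_eq[OF ev]) auto
  qed (auto intro: INF_greatest nonneg)
  moreover have "- (INF z\<in>G. rate_L \<alpha> x z) \<le> liminf (\<lambda>n. ereal (1 / n) * elog (measure (\<nu> n) G))"
    if "open G" for G
  proof -
    \<comment> \<open>Negating makes the pointwise bounds a lower bound for the infimum; outside
      \<open>[0, 1]\<close> the rate is infinite and the bound trivial.\<close>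
    have "- liminf (\<lambda>n. ereal (1 / n) * elog (scaled_prob \<alpha> x n G)) \<le> rate_L \<alpha> x z" if "z \<in> G" for z
      using scaled_prob_ldp_lower[OF assms(1-3) \<open>open G\<close> that] by (auto simp: rate_L_eq ereal_uminus_le_reorder)
    then have "- liminf (\<lambda>n. ereal (1 / n) * elog (scaled_prob \<alpha> x n G)) \<le> (INF z\<in>G. rate_L \<alpha> x z)"
      by (rule INF_greatest)
    then show ?thesis
      using that by (subst Liminf_eq[OF ev]) (auto simp: ereal_uminus_le_reorder)
  qed
  ultimately show ?thesis
    using good unfolding satisfies_good_LDP_def \<nu>_def by blast
qed

end
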